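(* Let $k\ge 1$ be an integer. If a finite simple graph $G$ has no $K_{k+2}$-minor, then $G$ has a $\Lambda_{\mathrm{odd}}$-selector of width $k$, where $\Lambda_{\mathrm{odd}}=\{1,3,5,\ldots\}$ is the set of odd positive integers.
   Context: All graphs are finite and simple. $N_G[x]$ denotes the closed neighborhood of $x$ in $G$, and $[p]=\{1,\ldots,p\}$. A graph $H$ is a minor of $G$ if $H$ can be obtained from $G$ by deleting edges and/or vertices and contracting edges. For a set $\Lambda$ of positive integers with $1\in\Lambda$, a $\Lambda$-selector of width $p$ in $G$ is a pair $(S,\varphi)$ consisting of an independent set $S\subseteq V(G)$ and a map $\varphi:S\to[p]$ such that, for every $x\in V(G)$, there is a color $i\in[p]$ with $|N_G[x]\cap\varphi^{-1}(i)|\in\Lambda$. *)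

theory Defs
  imports "Graph_Theory.Graph_Theory"
begin

text \<open>
  A finite simple graph is a \<^locale>\<open>pair_graph\<close>: a finite, symmetric, loop-free set of arcs
  \<^term>\<open>parcs G\<close>, an undirected edge $uv$ being the pair of arcs $(u,v)$, $(v,u)$.
\<close>

definition delete_vertex :: "'a pair_pre_digraph \<Rightarrow> 'a \<Rightarrow> 'a pair_pre_digraph" where
  "delete_vertex G v =
     \<lparr> pverts = pverts G - {v}, parcs = {(a, b). (a, b) \<in> parcs G \<and> a \<noteq> v \<and> b \<noteq> v} \<rparr>"

definition delete_edge :: "'a pair_pre_digraph \<Rightarrow> 'a \<Rightarrow> 'a \<Rightarrow> 'a pair_pre_digraph" where
  "delete_edge G u v = \<lparr> pverts = pverts G, parcs = parcs G - {(u, v), (v, u)} \<rparr>"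

text \<open>
  Contraction of $uv$ keeps the name $u$ for the merged vertex. The loop that arises is dropped,
  and parallel edges are identified since arcs form a set.
\<close>

definition contract_edge :: "'a pair_pre_digraph \<Rightarrow> 'a \<Rightarrow> 'a \<Rightarrow> 'a pair_pre_digraph" where
  "contract_edge G u v =
     (let c = (\<lambda>x. if x = v then u else x)
      in \<lparr> pverts = c ` pverts G, parcs = {(c a, c b) | a b. (a, b) \<in> parcs G \<and> c a \<noteq> c b} \<rparr>)"

inductive minor_step :: "'a pair_pre_digraph \<Rightarrow> 'a pair_pre_digraph \<Rightarrow> bool" where
  vertex_deletion: "v \<in> pverts G \<Longrightarrow> minor_step G (delete_vertex G v)"
| edge_deletion: "(u, v) \<in> parcs G \<Longrightarrow> minor_step G (delete_edge G u v)"
| edge_contraction: "(u, v) \<in> parcs G \<Longrightarrow> minor_step G (contract_edge G u v)"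

definition is_minor :: "'a pair_pre_digraph \<Rightarrow> 'a pair_pre_digraph \<Rightarrow> bool" where
  "is_minor H G \<longleftrightarrow> minor_step\<^sup>*\<^sup>* G H"

text \<open>
  Minors are taken up to isomorphism. Since \<^const>\<open>complete_digraph\<close> is a predicate selecting
  all complete graphs on $n$ vertices, it suffices to look for such a graph among the graphs
  produced by the operations, whose vertices are vertices of $G$.
\<close>

definition has_complete_minor :: "'a pair_pre_digraph \<Rightarrow> nat \<Rightarrow> bool" where
  "has_complete_minor G n \<longleftrightarrow> (\<exists>H. is_minor H G \<and> complete_digraph n (with_proj H))"

definition closed_nbhd :: "'a pair_pre_digraph \<Rightarrow> 'a \<Rightarrow> 'a set" where
  "closed_nbhd G x = insert x {y. (x, y) \<in> parcs G}"

definition independent_set :: "'a pair_pre_digraph \<Rightarrow> 'a set \<Rightarrow> bool" where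
  "independent_set G S \<longleftrightarrow> S \<subseteq> pverts G \<and> (\<forall>x\<in>S. \<forall>y\<in>S. (x, y) \<notin> parcs G)"

text \<open>
  Only the values of \<open>\<phi>\<close> on \<open>S\<close> matter; the preimage of \<open>i\<close> is therefore intersected with \<open>S\<close>.
  \<open>\<Lambda>\<close> is meant to consist of positive integers and to contain 1.
\<close>

definition selector ::
  "nat set \<Rightarrow> nat \<Rightarrow> 'a pair_pre_digraph \<Rightarrow> 'a set \<Rightarrow> ('a \<Rightarrow> nat) \<Rightarrow> bool" where
  "selector \<Lambda> p G S \<phi> \<longleftrightarrow>
     independent_set G S \<and> \<phi> \<in> S \<rightarrow> {1..p} \<and>
     (\<forall>x\<in>pverts G. \<exists>i\<in>{1..p}. card (closed_nbhd G x \<inter> {y \<in> S. \<phi> y = i}) \<in> \<Lambda>)"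

definition Lambda_odd :: "nat set" where
  "Lambda_odd = {n. odd n}"

lemma Lambda_odd_admissible: "1 \<in> Lambda_odd" "n \<in> Lambda_odd \<Longrightarrow> n > 0"
  by (auto simp: Lambda_odd_def odd_pos)

lemma pair_graph_iff:
  "pair_graph G \<longleftrightarrow>
     finite (pverts G) \<and> parcs G \<subseteq> pverts G \<times> pverts G \<and> sym (parcs G) \<and> irrefl (parcs G)"
  (is "?L \<longleftrightarrow> ?R")
proof
  assume ?L
  then interpret pair_graph G .
  have "(a, a) \<notin> parcs G" for a
    using pair_no_loops[of "(a, a)"] by auto
  then show ?R
    using pair_finite_verts pair_sym_arcs in_arcsD1 in_arcsD2
    by (auto simp: symmetric_def irrefl_def)
next
  assume R: ?R
  then have "finite (parcs G)"
    by (meson finite_SigmaI finite_subset)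
  with R show ?L
    by unfold_locales (auto simp: symmetric_def irrefl_def)
qed

lemma minor_step_pair_graph:
  assumes "minor_step G H" "pair_graph G"
  shows "pair_graph H"
  using assms
proof (induction rule: minor_step.induct)
  case (vertex_deletion v G)
  then show ?case by (auto simp: pair_graph_iff delete_vertex_def sym_def irrefl_def)
next
  case (edge_deletion u v G)
  then show ?case by (auto simp: pair_graph_iff delete_edge_def sym_def irrefl_def)
next
  case (edge_contraction u v G)
  define c where "c = (\<lambda>x. if x = v then u else x)"
  have eq: "contract_edge G u v =
    \<lparr> pverts = c ` pverts G, parcs = {(c a, c b) | a b. (a, b) \<in> parcs G \<and> c a \<noteq> c b} \<rparr>"
    by (simp add: contract_edge_def Let_def c_def)
  have fin: "finite (pverts G)" and sub: "parcs G \<subseteq> pverts G \<times> pverts G" and sym: "sym (parcs G)"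
    using edge_contraction by (simp_all add: pair_graph_iff)
  have "sym {(c a, c b) | a b. (a, b) \<in> parcs G \<and> c a \<noteq> c b}"
  proof (rule symI)
    fix x y assume "(x, y) \<in> {(c a, c b) | a b. (a, b) \<in> parcs G \<and> c a \<noteq> c b}"
    then obtain a b where "x = c a" "y = c b" "(a, b) \<in> parcs G" "c a \<noteq> c b" by blast
    moreover from this have "(b, a) \<in> parcs G" using sym by (blast dest: symD)
    ultimately show "(y, x) \<in> {(c a, c b) | a b. (a, b) \<in> parcs G \<and> c a \<noteq> c b}" by force
  qed
  moreover have "irrefl {(c a, c b) | a b. (a, b) \<in> parcs G \<and> c a \<noteq> c b}"
    by (rule irreflI) blast
  moreover have "{(c a, c b) | a b. (a, b) \<in> parcs G \<and> c a \<noteq> c b}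
      \<subseteq> c ` pverts G \<times> c ` pverts G"
    using sub by blast
  ultimately show ?case
    using fin unfolding eq pair_graph_iff by simp
qed

lemma is_minor_pair_graph: "is_minor H G \<Longrightarrow> pair_graph G \<Longrightarrow> pair_graph H"
  unfolding is_minor_def by (induction rule: rtranclp_induct) (auto intro: minor_step_pair_graph)

end

theory Submission
  imports Defs
begin

text \<open>
  Induction on \<open>k\<close>, with minors replaced by their branch sets. Choose a maximal set \<open>S\<close> of vertices
  with disjoint closed neighbourhoods such that \<open>N[S]\<close> induces a connected graph in each component.
  By maximality every remaining vertex has a neighbour in \<open>N[S]\<close>, so that the part of \<open>N[S]\<close> in the
  component of a $K_m$-model of \<open>G - N[S]\<close> is one more branch set. Hence \<open>G - N[S]\<close> has a smaller
  excluded minor and is handled with one colour less, while the new colour on \<open>S\<close> meets the closed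
  neighbourhood of each vertex of \<open>N[S]\<close> exactly once. For \<open>k = 1\<close> the graph is a forest, where one
  independent set serves all vertices; it is found by removing leaves.
\<close>

section \<open>Branch sets of complete minors\<close>

definition connected_in :: "'a rel \<Rightarrow> 'a set \<Rightarrow> bool" where
  "connected_in E X \<longleftrightarrow> (\<forall>x\<in>X. \<forall>y\<in>X. (x, y) \<in> (E \<inter> X \<times> X)\<^sup>*)"

text \<open>This is a model of a complete graph on \<open>card P\<close> vertices, the members of
  \<open>P\<close> being its branch sets. Nonemptiness is asked for separately because
  \<open>connected_in\<close> holds of the empty set.\<close>

definition clique_model :: "'a rel \<Rightarrow> 'a set set \<Rightarrow> bool" where
  "clique_model E P \<longleftrightarrow>
     (\<forall>X\<in>P. X \<noteq> {} \<and> connected_in E X) \<and>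
     (\<forall>X\<in>P. \<forall>Y\<in>P. X \<noteq> Y \<longrightarrow> X \<inter> Y = {} \<and> (\<exists>x\<in>X. \<exists>y\<in>Y. (x, y) \<in> E))"

lemma clique_model_adjacent:
  assumes "clique_model E P" "X \<in> P" "Y \<in> P" "X \<noteq> Y"
  shows "\<exists>x\<in>X. \<exists>y\<in>Y. (x, y) \<in> E"
  using assms by (simp add: clique_model_def)

lemma connected_in_singleton: "connected_in E {x}"
  by (simp add: connected_in_def)

lemma connected_in_insert:
  assumes "sym E" "connected_in E X" "y \<in> X" "(x, y) \<in> E"
  shows "connected_in E (insert x X)"
proof -
  let ?R = "E \<inter> insert x X \<times> insert x X"
  have mono: "(a, b) \<in> ?R\<^sup>*" if "(a, b) \<in> (E \<inter> X \<times> X)\<^sup>*" for a b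
    using that by (rule rtrancl_mono[THEN subsetD, rotated]) auto
  have old: "(a, b) \<in> ?R\<^sup>*" if "a \<in> X" "b \<in> X" for a b
    using assms(2) that mono by (auto simp: connected_in_def)
  have xy: "(x, y) \<in> ?R" "(y, x) \<in> ?R"
    using assms by (auto dest: symD)
  have "(x, b) \<in> ?R\<^sup>*" "(b, x) \<in> ?R\<^sup>*" if "b \<in> X" for b
    using old[OF assms(3) that] old[OF that assms(3)] xy
    by (auto intro: converse_rtrancl_into_rtrancl rtrancl_into_rtrancl)
  with old show ?thesis
    unfolding connected_in_def by auto
qed

lemma connected_in_path:
  assumes "sym E" "successively (\<lambda>a b. (a, b) \<in> E) xs"
  shows "connected_in E (set xs)"
  using assms(2)
proof (induction xs)
  case Nil
  then show ?case by (simp add: connected_in_def)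
next
  case (Cons x xs)
  show ?case
  proof (cases xs)
    case Nil
    then show ?thesis by (simp add: connected_in_singleton)
  next
    case (Cons y ys)
    with Cons.prems Cons.IH show ?thesis
      using connected_in_insert[OF assms(1), of "set xs" y x] by simp
  qed
qed

lemma connected_in_reachable:
  assumes "connected_in E X" "X \<subseteq> W" "x \<in> X" "y \<in> X"
  shows "(x, y) \<in> (E \<inter> W \<times> W)\<^sup>*"
proof -
  have "E \<inter> X \<times> X \<subseteq> E \<inter> W \<times> W" using assms(2) by auto
  with assms show ?thesis
    unfolding connected_in_def using rtrancl_mono by blast
qed

lemma clique_model_delete_vertex:
  assumes "clique_model (parcs G) P" "v \<notin> \<Union>P"
  shows "clique_model (parcs (delete_vertex G v)) P"
proof -
  have "parcs G \<inter> X \<times> X = parcs (delete_vertex G v) \<inter> X \<times> X" if "X \<in> P" for X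
    using assms(2) that by (auto simp: delete_vertex_def)
  then have "connected_in (parcs (delete_vertex G v)) X" if "X \<in> P" for X
    using assms(1) that by (simp add: clique_model_def connected_in_def)
  moreover have "\<exists>x\<in>X. \<exists>y\<in>Y. (x, y) \<in> parcs (delete_vertex G v)"
    if "X \<in> P" "Y \<in> P" "X \<noteq> Y" for X Y
  proof -
    obtain x y where "x \<in> X" "y \<in> Y" "(x, y) \<in> parcs G"
      using assms(1) \<open>X \<in> P\<close> \<open>Y \<in> P\<close> \<open>X \<noteq> Y\<close> unfolding clique_model_def by blast
    moreover from this have "x \<noteq> v" "y \<noteq> v" using assms(2) that by auto
    ultimately show ?thesis by (auto simp: delete_vertex_def)
  qed
  ultimately show ?thesis
    using assms(1) by (simp add: clique_model_def)
qed

text \<open>Taking images under the contraction map works: paths go to paths with possible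
  repetitions, and the images stay disjoint because both ends of the contracted edge lie in one
  branch set. The bound on the union keeps the new model inside the contracted graph, which has lost
  \<open>v\<close>.\<close>

lemma clique_model_contract_edge:
  assumes P: "clique_model (parcs G) P"
    and X: "X \<in> P" "u \<in> X" "v \<in> X" "u \<noteq> v"
  obtains P' where "clique_model (parcs (contract_edge G u v)) P'" "card P' = card P"
    "\<Union>P' \<subseteq> \<Union>P - {v}"
proof
  define c where "c = (\<lambda>x. if x = v then u else x)"
  let ?E = "parcs (contract_edge G u v)"
  have E: "?E = {(c a, c b) | a b. (a, b) \<in> parcs G \<and> c a \<noteq> c b}"
    by (simp add: contract_edge_def Let_def c_def)
  have disj: "Y \<inter> Z = {}" if "Y \<in> P" "Z \<in> P" "Y \<noteq> Z" for Y Z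
    using P that by (auto simp: clique_model_def)
  have sub: "c ` Y \<subseteq> Y - {v}" if "Y \<in> P" for Y
    using disj[OF that X(1)] X by (auto simp: c_def)
  have ne: "Y \<noteq> {}" if "Y \<in> P" for Y
    using P that by (auto simp: clique_model_def)
  have disj': "c ` Y \<inter> c ` Z = {}" if "Y \<in> P" "Z \<in> P" "Y \<noteq> Z" for Y Z
    using disj[OF that] sub[OF that(1)] sub[OF that(2)] by blast
  have inj: "inj_on ((`) c) P"
  proof (rule inj_onI, rule ccontr)
    fix Y Z assume "Y \<in> P" "Z \<in> P" "c ` Y = c ` Z" "Y \<noteq> Z"
    with disj'[of Y Z] ne[of Y] show False by auto
  qed
  have conn: "connected_in ?E (c ` Y)" if "Y \<in> P" for Y
  proof -
    have "(c a, c b) \<in> (?E \<inter> c ` Y \<times> c ` Y)\<^sup>*" if "(a, b) \<in> (parcs G \<inter> Y \<times> Y)\<^sup>*" for a b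
      using that
    proof induction
      case (step b d)
      then have "c b = c d \<or> (c b, c d) \<in> ?E \<inter> c ` Y \<times> c ` Y"
        unfolding E by blast
      with step.IH show ?case by (auto intro: rtrancl_into_rtrancl)
    qed simp
    moreover have "connected_in (parcs G) Y"
      using P that by (simp add: clique_model_def)
    ultimately show ?thesis
      unfolding connected_in_def by blast
  qed
  have adj: "\<exists>x\<in>c ` Y. \<exists>y\<in>c ` Z. (x, y) \<in> ?E" if YZ: "Y \<in> P" "Z \<in> P" "Y \<noteq> Z" for Y Z
  proof -
    obtain y z where yz: "y \<in> Y" "z \<in> Z" "(y, z) \<in> parcs G"
      using P YZ unfolding clique_model_def by blast
    then have "c y \<noteq> c z" using disj'[OF YZ] by blast
    with yz have "(c y, c z) \<in> ?E" unfolding E by blast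
    with yz show ?thesis by blast
  qed
  show "clique_model ?E ((`) c ` P)"
    unfolding clique_model_def
  proof (intro conjI ballI impI)
    fix Y assume "Y \<in> (`) c ` P"
    then show "Y \<noteq> {}" "connected_in ?E Y" using ne conn by auto
  next
    fix Y Z assume "Y \<in> (`) c ` P" "Z \<in> (`) c ` P" "Y \<noteq> Z"
    then obtain Y' Z' where "Y' \<in> P" "Z' \<in> P" "Y' \<noteq> Z'" "Y = c ` Y'" "Z = c ` Z'" by blast
    then show "Y \<inter> Z = {}" "\<exists>x\<in>Y. \<exists>y\<in>Z. (x, y) \<in> ?E"
      using disj' adj by simp_all
  qed
  show "card ((`) c ` P) = card P"
    by (rule card_image[OF inj])
  show "\<Union>((`) c ` P) \<subseteq> \<Union>P - {v}"
    using sub by blast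
qed

lemma complete_digraph_of_singletons:
  assumes G: "pair_graph G" and P: "clique_model (parcs G) P" "\<Union>P = pverts G"
    and single: "\<And>X x y. X \<in> P \<Longrightarrow> x \<in> X \<Longrightarrow> y \<in> X \<Longrightarrow> x = y"
  shows "complete_digraph (card P) (with_proj G)"
proof -
  have P_eq: "P = (\<lambda>x. {x}) ` pverts G"
  proof -
    have "X = {x}" if "X \<in> P" "x \<in> X" for X x
      using single that by blast
    moreover have "X \<noteq> {}" if "X \<in> P" for X
      using P(1) that by (simp add: clique_model_def)
    ultimately show ?thesis
      unfolding P(2)[symmetric] by (fastforce simp: image_iff)
  qed
  then have "card P = card (pverts G)"
    by (simp add: card_image)
  moreover have "(x, y) \<in> parcs G" if "x \<in> pverts G" "y \<in> pverts G" "x \<noteq> y" for x y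
  proof -
    have "{x} \<in> P" "{y} \<in> P" "{x} \<noteq> {y}" using P_eq that by auto
    from clique_model_adjacent[OF P(1) this] show ?thesis by simp
  qed
  ultimately show ?thesis
    using G unfolding complete_digraph_pair_def by (auto simp: pair_graph_iff irrefl_def)
qed

lemma minor_step_has_complete_minor:
  assumes "minor_step G H" "has_complete_minor H n"
  shows "has_complete_minor G n"
proof -
  obtain K where "minor_step\<^sup>*\<^sup>* H K" "complete_digraph n (with_proj K)"
    using assms(2) by (auto simp: has_complete_minor_def is_minor_def)
  moreover from this(1) have "minor_step\<^sup>*\<^sup>* G K"
    by (rule converse_rtranclp_into_rtranclp[of minor_step, OF assms(1)])
  ultimately show ?thesis
    unfolding has_complete_minor_def is_minor_def by (intro exI conjI)
qed

text \<open>Each operation lowers the number of vertices: delete a vertex outside all branch sets,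
  or contract an edge inside a branch set with two vertices. If neither is possible, the branch sets
  are singletons exhausting the graph, which is then complete.\<close>

lemma clique_model_has_complete_minor:
  assumes "pair_graph G" "clique_model (parcs G) P" "\<Union>P \<subseteq> pverts G"
  shows "has_complete_minor G (card P)"
  using assms
proof (induction "card (pverts G)" arbitrary: G P rule: less_induct)
  case less
  have fin: "finite (pverts G)" using less.prems(1) by (simp add: pair_graph_iff)
  show ?case
  proof (cases "\<Union>P = pverts G")
    case False
    then obtain v where v: "v \<in> pverts G" "v \<notin> \<Union>P" using less.prems(3) by blast
    let ?H = "delete_vertex G v"
    have step: "minor_step G ?H" by (rule vertex_deletion) fact
    have "card (pverts ?H) < card (pverts G)"
      using card_Diff1_less[OF fin v(1)] by (simp add: delete_vertex_def)
    moreover have "\<Union>P \<subseteq> pverts ?H"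
      using v less.prems(3) by (auto simp: delete_vertex_def)
    ultimately have "has_complete_minor ?H (card P)"
      using less.hyps minor_step_pair_graph[OF step less.prems(1)]
        clique_model_delete_vertex[OF less.prems(2) v(2)] by blast
    with step show ?thesis by (rule minor_step_has_complete_minor)
  next
    case True
    show ?thesis
    proof (cases "\<forall>X\<in>P. \<forall>x\<in>X. \<forall>y\<in>X. x = y")
      case single: True
      have "complete_digraph (card P) (with_proj G)"
        using complete_digraph_of_singletons[OF less.prems(1,2) True] single by blast
      then show ?thesis
        unfolding has_complete_minor_def is_minor_def by blast
    next
      case False
      then obtain X x y where X: "X \<in> P" "x \<in> X" "y \<in> X" "x \<noteq> y" by blast
      then have "(x, y) \<in> (parcs G \<inter> X \<times> X)\<^sup>*"
        using less.prems(2) by (simp add: clique_model_def connected_in_def)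
      \<comment> \<open>The first edge of a path from \<open>x\<close> to \<open>y\<close> inside
        \<open>X\<close> is the one to contract.\<close>
      with \<open>x \<noteq> y\<close> obtain z where z: "(x, z) \<in> parcs G" "z \<in> X"
        by (auto elim: converse_rtranclE)
      have "x \<noteq> z"
        using z less.prems(1) by (auto simp: pair_graph_iff irrefl_def)
      let ?H = "contract_edge G x z"
      have step: "minor_step G ?H" by (rule edge_contraction) fact
      obtain P' where P': "clique_model (parcs ?H) P'" "card P' = card P" "\<Union>P' \<subseteq> \<Union>P - {z}"
        using clique_model_contract_edge[OF less.prems(2) X(1,2) z(2) \<open>x \<noteq> z\<close>] .
      have V: "pverts ?H = pverts G - {z}"
        using \<open>x \<noteq> z\<close> X(1,2) less.prems(3)
        by (auto simp: contract_edge_def Let_def image_iff)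
      have "z \<in> pverts G" using z X less.prems(3) by blast
      then have "card (pverts ?H) < card (pverts G)"
        unfolding V using fin by (intro card_Diff1_less)
      moreover have "\<Union>P' \<subseteq> pverts ?H"
        using P'(3) True V by simp
      ultimately have "has_complete_minor ?H (card P)"
        using less.hyps minor_step_pair_graph[OF step less.prems(1)] P' by metis
      with step show ?thesis by (rule minor_step_has_complete_minor)
    qed
  qed
qed

section \<open>Cycles and leaves\<close>

text \<open>A cycle contracts to a triangle: the ends \<open>x\<close> and \<open>z\<close> of the
  closing edge are kept as singletons, and the interior \<open>ys\<close> of the path is the third
  branch set.\<close>

lemma triangle_model:
  assumes "sym E" "irrefl E" "distinct (x # ys @ [z])" "ys \<noteq> []"
    and path: "successively (\<lambda>a b. (a, b) \<in> E) (x # ys @ [z])" and "(x, z) \<in> E"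
  shows "clique_model E {{x}, set ys, {z}}" "card {{x}, set ys, {z}} = 3"
proof -
  have "successively (\<lambda>a b. (a, b) \<in> E) ys"
    and "(x, hd ys) \<in> E" "(last ys, z) \<in> E"
    using path \<open>ys \<noteq> []\<close> by (auto simp: successively_append_iff successively_Cons)
  moreover have "(hd ys, x) \<in> E" "(z, last ys) \<in> E" "(z, x) \<in> E"
    using calculation assms by (auto dest: symD)
  moreover have "hd ys \<in> set ys" "last ys \<in> set ys"
    using \<open>ys \<noteq> []\<close> by auto
  ultimately show "clique_model E {{x}, set ys, {z}}"
    using assms(3,4,6) connected_in_path[OF assms(1)]
    by (auto simp: clique_model_def connected_in_singleton)
  have "{x} \<noteq> set ys" "{z} \<noteq> set ys" "x \<noteq> z"
    using assms(3,4) by auto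
  then show "card {{x}, set ys, {z}} = 3" by auto
qed

text \<open>The first vertex of a longest path has all its neighbours on the path, and a neighbour
  other than the second vertex closes a cycle. Since \<open>p\<close> need not be adjacent to
  \<open>v\<close>, isolated vertices are covered as well.\<close>

lemma exists_leaf:
  assumes "finite W" "W \<noteq> {}" "sym E" "irrefl E"
    and no_triangle: "\<nexists>P. clique_model E P \<and> card P = 3 \<and> \<Union>P \<subseteq> W"
  obtains v p where "v \<in> W" "E `` {v} \<inter> W \<subseteq> {p}"
proof (rule ccontr)
  assume "\<not> thesis"
  with that have branch: "\<exists>q\<in>W. (v, q) \<in> E \<and> q \<noteq> p" if "v \<in> W" for v p
    using that by blast
  define path where "path = (\<lambda>xs. xs \<noteq> [] \<and> set xs \<subseteq> W \<and> distinct xs \<and>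
    successively (\<lambda>a b. (a, b) \<in> E) xs)"
  obtain w where "w \<in> W" using assms(2) by blast
  then have "path [w]" by (simp add: path_def)
  moreover have "length xs < Suc (card W)" if "path xs" for xs
    using that card_mono[OF assms(1), of "set xs"] distinct_card[of xs]
    by (simp add: path_def)
  ultimately obtain xs where xs: "path xs" and longest: "\<And>ys. path ys \<Longrightarrow> length ys \<le> length xs"
    using ex_has_greatest_nat[of path "[w]" length "Suc (card W)"] by blast
  then obtain x zs where x: "xs = x # zs" "x \<in> W" by (cases xs) (auto simp: path_def)
  \<comment> \<open>If \<open>zs\<close> is empty, \<open>hd zs\<close> is an unspecified value.
    This is harmless: maximality forces \<open>q\<close> onto the path, whose only vertex
    \<open>x\<close> is excluded.\<close>
  obtain q where q: "q \<in> W" "(x, q) \<in> E" "q \<noteq> hd zs"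
    using branch[OF x(2)] by blast
  have "q \<in> set xs"
  proof (rule ccontr)
    assume "q \<notin> set xs"
    then have "path (q # xs)"
      using xs q x assms(3) by (auto simp: path_def dest: symD)
    with longest show False by fastforce
  qed
  moreover have "q \<noteq> x" using q assms(4) by (auto simp: irrefl_def)
  ultimately obtain ys us where zs: "zs = ys @ q # us"
    using x by (auto dest: split_list)
  \<comment> \<open>As \<open>q\<close> is not the second vertex of the path, the edge from
    \<open>x\<close> to \<open>q\<close> is a genuine chord.\<close>
  have "ys \<noteq> []" using zs q by auto
  moreover have "distinct (x # ys @ [q])" "successively (\<lambda>a b. (a, b) \<in> E) (x # ys @ [q])"
    using xs x zs \<open>ys \<noteq> []\<close>
    by (auto simp: path_def successively_append_iff successively_Cons split: if_splits)
  ultimately have "clique_model E {{x}, set ys, {q}}" "card {{x}, set ys, {q}} = 3"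
    using triangle_model[OF assms(3,4)] q by blast+
  moreover have "\<Union>{{x}, set ys, {q}} \<subseteq> W"
    using xs x zs by (auto simp: path_def)
  ultimately show False using no_triangle by blast
qed

section \<open>Independent sets in forests with forbidden states\<close>

text \<open>\<open>None\<close> stands for membership in \<open>S\<close>, so a vertex has three
  possible states. Outside \<open>S\<close> only the parity of the number of neighbours in
  \<open>S\<close> is recorded.\<close>

definition domination_state :: "'a rel \<Rightarrow> 'a set \<Rightarrow> 'a \<Rightarrow> bool option" where
  "domination_state E S x = (if x \<in> S then None else Some (odd (card (E `` {x} \<inter> S))))"

definition avoiding_set :: "'a rel \<Rightarrow> 'a set \<Rightarrow> ('a \<Rightarrow> bool option) \<Rightarrow> 'a set \<Rightarrow> bool" where
  "avoiding_set E W g S \<longleftrightarrow> S \<subseteq> W \<and> (\<forall>x\<in>S. \<forall>y\<in>S. (x, y) \<notin> E) \<and>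
     (\<forall>x\<in>W. domination_state E S x \<noteq> g x)"

lemma avoiding_setD: "avoiding_set E W g S \<Longrightarrow> x \<in> W \<Longrightarrow> domination_state E S x \<noteq> g x"
  by (simp add: avoiding_set_def)

lemma avoiding_set_update:
  assumes "avoiding_set E W (g(p := h)) S" "domination_state E S p \<noteq> h'"
  shows "avoiding_set E W (g(p := h')) S"
  using assms by (auto simp: avoiding_set_def split: if_splits)

text \<open>Leaving \<open>v\<close> out changes no other state, and the only neighbour that
  \<open>v\<close> can have in \<open>S\<close> is \<open>p\<close>, which determines the state of
  \<open>v\<close>.\<close>

lemma avoiding_set_leaf_outside:
  assumes "avoiding_set E (W - {v}) g S" "E `` {v} \<inter> W \<subseteq> {p}"
    and "g v \<noteq> Some ((v, p) \<in> E \<and> p \<in> S)"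
  shows "avoiding_set E W g S"
proof -
  have "S \<subseteq> W - {v}" using assms(1) by (simp add: avoiding_set_def)
  then have "E `` {v} \<inter> S = (if (v, p) \<in> E \<and> p \<in> S then {p} else {})" and "v \<notin> S"
    using assms(2) by auto
  then have "domination_state E S v = Some ((v, p) \<in> E \<and> p \<in> S)"
    unfolding domination_state_def by simp
  then have "domination_state E S v \<noteq> g v"
    using assms(3) by metis
  then show ?thesis
    using assms(1) unfolding avoiding_set_def by blast
qed

text \<open>Adding \<open>v\<close> gives it the state \<open>None\<close> and flips the parity at
  an adjacent \<open>p\<close>, while no other state changes. Hence the smaller problem has to
  forbid the flipped state at \<open>p\<close>.\<close>

lemma avoiding_set_leaf_inside:
  assumes "finite W" "sym E" "irrefl E" "v \<in> W"
    and S: "avoiding_set E (W - {v}) (if (v, p) \<in> E then g(p := map_option Not (g p)) else g) S"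
    and v: "E `` {v} \<inter> W \<subseteq> {p}" "g v \<noteq> None" "(v, p) \<in> E \<Longrightarrow> p \<notin> S"
  shows "avoiding_set E W g (insert v S)"
proof -
  have sub: "S \<subseteq> W - {v}" and indep: "\<And>x y. x \<in> S \<Longrightarrow> y \<in> S \<Longrightarrow> (x, y) \<notin> E"
    using S by (simp_all add: avoiding_set_def)
  have vv: "(v, v) \<notin> E" using assms(3) by (simp add: irrefl_def)
  have vs: "(x, v) \<in> E \<longleftrightarrow> (v, x) \<in> E" for x using assms(2) by (auto dest: symD)
  have v_S: "(v, x) \<notin> E" if "x \<in> S" for x
    using that sub v(1,3) by blast
  have "domination_state E (insert v S) x \<noteq> g x" if "x \<in> W" for x
  proof -
    consider "x = v" | "x \<in> W - {v}" "(v, x) \<in> E" | "x \<in> W - {v}" "(v, x) \<notin> E"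
      using \<open>x \<in> W\<close> by blast
    then show ?thesis
    proof cases
      case 1
      then show ?thesis using v(2) by (auto simp: domination_state_def)
    next
      case 2
      then have x: "x = p" using v(1) by blast
      then have "x \<notin> S" using 2(2) v(3) by simp
      have "E `` {x} \<inter> insert v S = insert v (E `` {x} \<inter> S)" using 2 vs by auto
      moreover have "finite (E `` {x} \<inter> S)" "v \<notin> E `` {x} \<inter> S"
        using sub assms(1) by (auto intro: finite_subset)
      ultimately have "domination_state E (insert v S) x = map_option Not (domination_state E S x)"
        using 2 \<open>x \<notin> S\<close> by (simp add: domination_state_def)
      \<comment> \<open>\<open>map_option Not\<close> is an involution, so flipping both sides turns
        this into the required inequality.\<close>
      moreover have "domination_state E S x \<noteq> map_option Not (g x)"
        using avoiding_setD[OF S 2(1)] 2(2) x by simp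
      ultimately show ?thesis
        by (cases "g x"; cases "domination_state E S x") simp_all
    next
      case 3
      then have "(x, v) \<notin> E" using vs by simp
      then have "E `` {x} \<inter> insert v S = E `` {x} \<inter> S" by auto
      then have "domination_state E (insert v S) x = domination_state E S x"
        using 3 by (simp add: domination_state_def)
      \<comment> \<open>If \<open>p\<close> is adjacent to \<open>v\<close>, then \<open>x\<close>
        differs from \<open>p\<close>, so the update at \<open>p\<close> is not seen here.\<close>
      moreover have "domination_state E S x \<noteq> g x"
        using avoiding_setD[OF S 3(1)] 3(2) v(1) by (auto split: if_splits)
      ultimately show ?thesis by simp
    qed
  qed
  moreover have "\<forall>x\<in>insert v S. \<forall>y\<in>insert v S. (x, y) \<notin> E"
    using indep v_S vv v_S[unfolded vs[symmetric]] by (intro ballI) (elim insertE; simp)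
  moreover have "insert v S \<subseteq> W"
    using sub assms(4) by blast
  ultimately show ?thesis
    by (simp add: avoiding_set_def)
qed

text \<open>
  Forbidding an arbitrary one of the three states at each vertex makes the statement survive the
  removal of a leaf: the constraint at the leaf turns into a forbidden state at its neighbour.
\<close>

lemma exists_avoiding_set_forest:
  assumes "finite W" "sym E" "irrefl E"
    and "\<nexists>P. clique_model E P \<and> card P = 3 \<and> \<Union>P \<subseteq> W"
  shows "\<exists>S. avoiding_set E W g S"
  using assms(1,4)
proof (induction "card W" arbitrary: W g rule: less_induct)
  case less
  show ?case
  proof (cases "W = {}")
    case True
    then show ?thesis by (auto simp: avoiding_set_def)
  next
    case False
    then obtain v p where v: "v \<in> W" "E `` {v} \<inter> W \<subseteq> {p}"
      using exists_leaf[OF less.prems(1) _ assms(2,3) less.prems(2)] by blast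
    have IH: "\<exists>S. avoiding_set E (W - {v}) g' S" for g'
    proof (rule less.hyps)
      show "card (W - {v}) < card W" using less.prems(1) v(1) by (rule card_Diff1_less)
      show "finite (W - {v})" using less.prems(1) by simp
      show "\<nexists>P. clique_model E P \<and> card P = 3 \<and> \<Union>P \<subseteq> W - {v}"
        using less.prems(2) by blast
    qed
    note outside = avoiding_set_leaf_outside[OF _ v(2)]
    note inside = avoiding_set_leaf_inside[OF less.prems(1) assms(2,3) v(1) _ v(2)]
    show ?thesis
    proof (cases "g v")
      case None
      \<comment> \<open>Only membership is forbidden at \<open>v\<close>, so leaving
        \<open>v\<close> out always works.\<close>
      obtain S where "avoiding_set E (W - {v}) g S" using IH by blast
      from outside[OF this] None show ?thesis by auto
    next
      case (Some b)
      consider "(v, p) \<notin> E" | "(v, p) \<in> E" "b" | "(v, p) \<in> E" "\<not> b" by blast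
      then show ?thesis
      proof cases
        case 1
        \<comment> \<open>Here \<open>v\<close> is isolated in \<open>W\<close> and can be added
          without affecting other vertices.\<close>
        obtain S where "avoiding_set E (W - {v}) g S" using IH by blast
        with inside[of g S] 1 Some show ?thesis by auto
      next
        case 2
        \<comment> \<open>Forbidding \<open>None\<close> keeps \<open>p\<close> out of
          \<open>S\<close>, so both choices for \<open>v\<close> are allowed. They give
          \<open>p\<close> opposite parities, and at least one of these avoids
          \<open>g p\<close>.\<close>
        obtain S where S: "avoiding_set E (W - {v}) (g(p := None)) S" using IH by blast
        have "p \<notin> S"
        proof
          assume "p \<in> S"
          then have "p \<in> W - {v}" "domination_state E S p = None"
            using S by (auto simp: avoiding_set_def domination_state_def)
          with avoiding_setD[OF S, of p] show False by simp
        qed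
        show ?thesis
        proof (cases "domination_state E S p = g p")
          case True
          then have "domination_state E S p \<noteq> map_option Not (g p)"
            using \<open>p \<notin> S\<close> by (cases "g p") (auto simp: domination_state_def)
          from avoiding_set_update[OF S this] inside[of g S] 2 \<open>p \<notin> S\<close> Some
          show ?thesis by auto
        next
          case False
          from outside[OF avoiding_set_update[OF S False, unfolded fun_upd_triv]] 2 \<open>p \<notin> S\<close> Some
          show ?thesis by auto
        qed
      next
        case 3
        \<comment> \<open>If \<open>p\<close> is in \<open>S\<close>, leaving \<open>v\<close> out
          gives \<open>v\<close> odd parity. Otherwise \<open>v\<close> is added, and the flip at
          \<open>p\<close> matches the flipped constraint.\<close>
        obtain S where S: "avoiding_set E (W - {v}) (g(p := map_option Not (g p))) S"
          using IH by blast
        show ?thesis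
        proof (cases "p \<in> S")
          case True
          then have "p \<in> W - {v}" "domination_state E S p = None"
            using S by (auto simp: avoiding_set_def domination_state_def)
          with avoiding_setD[OF S, of p] have "domination_state E S p \<noteq> g p"
            by auto
          from outside[OF avoiding_set_update[OF S this, unfolded fun_upd_triv]] 3 True Some
          show ?thesis by auto
        next
          case False
          with S inside[of g S] 3 Some show ?thesis by auto
        qed
      qed
    qed
  qed
qed

section \<open>Packings with connected closed neighbourhood\<close>

definition closed_nbhd_within :: "'a rel \<Rightarrow> 'a set \<Rightarrow> 'a set" where
  "closed_nbhd_within E S = S \<union> E `` S"

lemma closed_nbhd_within_insert:
  "closed_nbhd_within E (insert u S) = closed_nbhd_within E {u} \<union> closed_nbhd_within E S"
  by (auto simp: closed_nbhd_within_def)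

text \<open>The second condition says that N[S] meets each component of \<open>E\<close> in a
  connected set, possibly an empty one. The first makes every vertex of N[S] see exactly one vertex
  of \<open>S\<close> in its closed neighbourhood.\<close>

definition linked_packing :: "'a rel \<Rightarrow> 'a set \<Rightarrow> bool" where
  "linked_packing E S \<longleftrightarrow>
     (\<forall>s\<in>S. \<forall>t\<in>S. s \<noteq> t \<longrightarrow> closed_nbhd_within E {s} \<inter> closed_nbhd_within E {t} = {}) \<and>
     (\<forall>a\<in>closed_nbhd_within E S. \<forall>b\<in>closed_nbhd_within E S. (a, b) \<in> E\<^sup>* \<longrightarrow>
       (a, b) \<in> (E \<inter> closed_nbhd_within E S \<times> closed_nbhd_within E S)\<^sup>*)"

text \<open>The star around \<open>u\<close> is connected in itself. If its component already meets
  N[S], a neighbour \<open>v\<close> of \<open>u\<close> is adjacent to N[S], which joins the star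
  to the old part.\<close>

lemma linked_packing_insert:
  assumes S: "linked_packing E S" and E: "sym E"
    and disj: "closed_nbhd_within E {u} \<inter> closed_nbhd_within E S = {}"
    and link: "\<And>a. a \<in> closed_nbhd_within E S \<Longrightarrow> (u, a) \<in> E\<^sup>* \<Longrightarrow>
      \<exists>v w. (u, v) \<in> E \<and> (v, w) \<in> E \<and> w \<in> closed_nbhd_within E S"
  shows "linked_packing E (insert u S)"
proof -
  let ?N = "closed_nbhd_within E"
  let ?N' = "?N (insert u S)"
  let ?R = "E \<inter> ?N' \<times> ?N'"
  have N': "?N' = ?N {u} \<union> ?N S" by (rule closed_nbhd_within_insert)
  have symE: "sym (E\<^sup>*)" and symR: "sym (?R\<^sup>*)"
    using E by (intro sym_rtrancl; auto simp: sym_def)+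
  have u: "u \<in> ?N {u}" by (simp add: closed_nbhd_within_def)
  have to_u: "(u, a) \<in> ?R\<^sup>*" if "a \<in> ?N {u}" for a
  proof (cases "a = u")
    case False
    then have "(u, a) \<in> ?R" using that u N' by (auto simp: closed_nbhd_within_def)
    then show ?thesis by blast
  qed simp
  have mono: "E \<inter> ?N S \<times> ?N S \<subseteq> ?R" using N' by auto
  have old: "(a, b) \<in> ?R\<^sup>*" if "a \<in> ?N S" "b \<in> ?N S" "(a, b) \<in> E\<^sup>*" for a b
    using S that rtrancl_mono[OF mono] unfolding linked_packing_def by blast
  \<comment> \<open>The route goes from \<open>a\<close> to the centre \<open>u\<close>, on to
    \<open>v\<close>, across to \<open>w\<close>, and from there to \<open>b\<close> within
    N[S].\<close>
  have mixed: "(a, b) \<in> ?R\<^sup>*" if ab: "a \<in> ?N {u}" "b \<in> ?N S" "(a, b) \<in> E\<^sup>*" for a b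
  proof -
    have ua: "(u, a) \<in> E\<^sup>*" using ab(1) by (auto simp: closed_nbhd_within_def)
    then obtain v w where vw: "(u, v) \<in> E" "(v, w) \<in> E" "w \<in> ?N S"
      using link[OF ab(2)] ab(3) by (meson rtrancl_trans)
    have "(u, b) \<in> E\<^sup>*" using ua ab(3) by (rule rtrancl_trans)
    moreover have "(w, u) \<in> E\<^sup>*"
      using vw(1,2) E by (meson symD converse_rtrancl_into_rtrancl rtrancl.rtrancl_refl)
    ultimately have "(w, b) \<in> E\<^sup>*" by (meson rtrancl_trans)
    then have "(w, b) \<in> ?R\<^sup>*" using old vw(3) ab(2) by blast
    moreover have v: "v \<in> ?N {u}" using vw(1) by (simp add: closed_nbhd_within_def)
    then have "(v, w) \<in> ?R" using vw N' by auto
    moreover have "(a, u) \<in> ?R\<^sup>*" using to_u[OF ab(1)] symR by (rule symD[rotated])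
    ultimately show ?thesis
      using to_u[OF v] by (meson rtrancl_trans converse_rtrancl_into_rtrancl)
  qed
  show ?thesis
    unfolding linked_packing_def
  proof (intro conjI ballI impI)
    fix s t assume st: "s \<in> insert u S" "t \<in> insert u S" "s \<noteq> t"
    have sub: "?N {r} \<subseteq> ?N S" if "r \<in> S" for r
      using that by (auto simp: closed_nbhd_within_def)
    consider "s \<in> S" "t \<in> S" | "s = u" "t \<in> S" | "t = u" "s \<in> S" using st by blast
    then show "?N {s} \<inter> ?N {t} = {}"
    proof cases
      case 1
      then show ?thesis using S st(3) by (simp add: linked_packing_def)
    qed (use sub disj in blast)+
  next
    fix a b assume ab: "a \<in> ?N'" "b \<in> ?N'" "(a, b) \<in> E\<^sup>*"
    consider "a \<in> ?N S" "b \<in> ?N S" | "a \<in> ?N {u}" "b \<in> ?N S" | "a \<in> ?N S" "b \<in> ?N {u}"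
      | "a \<in> ?N {u}" "b \<in> ?N {u}"
      using ab N' by blast
    then show "(a, b) \<in> ?R\<^sup>*"
    proof cases
      case 1
      then show ?thesis using old ab(3) by blast
    next
      case 2
      then show ?thesis using mixed ab(3) by blast
    next
      case 3
      then show ?thesis using mixed ab(3) symE symR by (meson symD)
    next
      case 4
      then show ?thesis using to_u symR by (meson symD rtrancl_trans)
    qed
  qed
qed

text \<open>A maximal linked packing works: from a vertex at distance more than one from N[S] one
  finds a vertex \<open>u\<close> that could still be added.\<close>

lemma exists_covering_linked_packing:
  assumes "finite W" "E \<subseteq> W \<times> W" "sym E"
  obtains S where "S \<subseteq> W" "linked_packing E S"
    "W \<subseteq> closed_nbhd_within E S \<union> E `` closed_nbhd_within E S"
proof -
  let ?N = "closed_nbhd_within E"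
  let ?F = "{S. S \<subseteq> W \<and> linked_packing E S}"
  have "finite ?F" using assms(1) by simp
  moreover have "{} \<in> ?F"
    by (simp add: linked_packing_def closed_nbhd_within_def)
  then have "?F \<noteq> {}" by (rule ex_in_conv[THEN iffD1, OF exI])
  ultimately have "\<exists>S\<in>?F. \<forall>T\<in>?F. S \<subseteq> T \<longrightarrow> S = T"
    by (rule finite_has_maximal)
  then obtain S where "S \<in> ?F" and max: "\<And>T. T \<in> ?F \<Longrightarrow> S \<subseteq> T \<Longrightarrow> S = T"
    by (elim bexE) simp
  then have S: "S \<subseteq> W" "linked_packing E S" by auto
  let ?P = "?N S \<union> E `` ?N S"
  have "x \<in> ?P" if "x \<in> W" for x
  proof (rule ccontr)
    assume "x \<notin> ?P"
    have "\<exists>u\<in>W - ?P. \<forall>a\<in>?N S. (u, a) \<in> E\<^sup>* \<longrightarrow>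
        (\<exists>v w. (u, v) \<in> E \<and> (v, w) \<in> E \<and> w \<in> ?N S)"
    proof (cases "\<exists>a\<in>?N S. (x, a) \<in> E\<^sup>*")
      case True
      then obtain a where a: "(x, a) \<in> E\<^sup>*" "a \<in> ?N S" by blast
      \<comment> \<open>A path from \<open>x\<close> to N[S] has to enter \<open>?P\<close>. The
        vertex \<open>c\<close> just before the entry lies at distance two from N[S] and serves as
        \<open>u\<close>.\<close>
      have "\<exists>c d. (c, d) \<in> E \<and> c \<notin> ?P \<and> d \<in> ?P"
      proof (rule ccontr)
        assume none: "\<not> ?thesis"
        from a(1) have "a \<notin> ?P"
          by induction (use \<open>x \<notin> ?P\<close> none in blast)+
        with a(2) show False by blast
      qed
      then obtain c d where cd: "(c, d) \<in> E" "c \<notin> ?P" "d \<in> ?P" by blast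
      moreover have "d \<notin> ?N S" using cd assms(3) by (blast dest: symD)
      ultimately obtain w where "w \<in> ?N S" "(d, w) \<in> E"
        using assms(3) by (blast dest: symD)
      moreover have "c \<in> W" using cd(1) assms(2) by blast
      ultimately show ?thesis using cd by blast
    \<comment> \<open>No vertex of N[S] is reachable from \<open>x\<close>, so \<open>x\<close>
      itself serves and the linking condition is vacuous.\<close>
    qed (use \<open>x \<notin> ?P\<close> that in blast)
    then obtain u where u: "u \<in> W" "u \<notin> ?P" and link: "\<And>a. a \<in> ?N S \<Longrightarrow> (u, a) \<in> E\<^sup>* \<Longrightarrow>
        \<exists>v w. (u, v) \<in> E \<and> (v, w) \<in> E \<and> w \<in> ?N S"
      by blast
    have "?N {u} \<inter> ?N S = {}"
      using u(2) assms(3) by (auto simp: closed_nbhd_within_def dest: symD)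
    then have "linked_packing E (insert u S)"
      using link by (rule linked_packing_insert[OF S(2) assms(3)])
    then have "S = insert u S" using max[of "insert u S"] S(1) u(1) by blast
    then have "u \<in> ?N S" by (auto simp: closed_nbhd_within_def)
    with u(2) show False by blast
  qed
  with S that show thesis by blast
qed

text \<open>All branch sets lie in one component, being connected and pairwise adjacent. The part of
  N[S] in that component is connected, and by the covering property every vertex of every branch set
  has a neighbour in it.\<close>

lemma clique_model_extend:
  assumes "sym E" "clique_model E P" "P \<noteq> {}" "\<Union>P \<subseteq> W - closed_nbhd_within (E \<inter> W \<times> W) S"
    and S: "S \<subseteq> W" "linked_packing (E \<inter> W \<times> W) S"
    and cover: "W \<subseteq> closed_nbhd_within (E \<inter> W \<times> W) S \<union>
      (E \<inter> W \<times> W) `` closed_nbhd_within (E \<inter> W \<times> W) S"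
  obtains D where "clique_model E (insert D P)" "D \<notin> P" "D \<subseteq> W"
proof -
  define F where "F = E \<inter> W \<times> W"
  define N where "N = closed_nbhd_within F S"
  have symF: "sym F" using assms(1) by (auto simp: F_def sym_def)
  obtain B where "B \<in> P" using assms(3) by blast
  with assms(2) obtain b where b: "b \<in> B" by (fastforce simp: clique_model_def)
  \<comment> \<open>The vertex \<open>b\<close> of some branch set serves only to name the
    component.\<close>
  define D where "D = {d \<in> N. (d, b) \<in> F\<^sup>*}"
  have NW: "N \<subseteq> W" using S(1) by (auto simp: N_def closed_nbhd_within_def F_def)
  have PW: "X \<subseteq> W - N" if "X \<in> P" for X
    using assms(4) that by (auto simp: N_def F_def)
  have inside: "(x, y) \<in> F\<^sup>*" if "X \<in> P" "x \<in> X" "y \<in> X" for X x y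
    unfolding F_def
    by (rule connected_in_reachable[of E X])
      (use assms(2) PW that in \<open>auto simp: clique_model_def\<close>)
  have to_b: "(x, b) \<in> F\<^sup>*" if X: "X \<in> P" "x \<in> X" for X x
  proof (cases "X = B")
    case True
    then show ?thesis using inside X b \<open>B \<in> P\<close> by blast
  next
    case False
    then obtain y z where yz: "y \<in> X" "z \<in> B" "(y, z) \<in> E"
      using assms(2) X(1) \<open>B \<in> P\<close> unfolding clique_model_def by blast
    then have "(y, z) \<in> F" using PW X(1) \<open>B \<in> P\<close> by (auto simp: F_def)
    then show ?thesis
      using inside[OF X yz(1)] inside[OF \<open>B \<in> P\<close> yz(2) b]
      by (meson rtrancl_trans converse_rtrancl_into_rtrancl)
  qed
  have adj: "\<exists>d\<in>D. \<exists>x\<in>X. (d, x) \<in> E \<and> (x, d) \<in> E" if X: "X \<in> P" for X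
  proof -
    obtain x where x: "x \<in> X" using assms(2) X by (fastforce simp: clique_model_def)
    then have "x \<in> W - N" using PW X by blast
    then obtain d where d: "d \<in> N" "(d, x) \<in> F"
      using cover by (auto simp: N_def F_def)
    then have "d \<in> D"
      using to_b[OF X x] by (auto simp: D_def intro: converse_rtrancl_into_rtrancl)
    moreover have "(d, x) \<in> E" "(x, d) \<in> E"
      using d(2) assms(1) by (auto simp: F_def dest: symD)
    ultimately show ?thesis using x by blast
  qed
  have "connected_in E D"
    unfolding connected_in_def
  proof (intro ballI)
    fix x y assume "x \<in> D" "y \<in> D"
    then have "(x, y) \<in> F\<^sup>*"
      using sym_rtrancl[OF symF] by (auto simp: D_def dest: symD intro: rtrancl_trans)
    then have "(x, y) \<in> (F \<inter> N \<times> N)\<^sup>*"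
      using S(2) \<open>x \<in> D\<close> \<open>y \<in> D\<close> by (auto simp: linked_packing_def N_def D_def F_def)
    \<comment> \<open>Membership in \<open>D\<close> is carried along the induction: a path within
      \<open>N\<close> that starts in \<open>D\<close> never leaves the component of
      \<open>b\<close>.\<close>
    then have "y \<in> D \<and> (x, y) \<in> (E \<inter> D \<times> D)\<^sup>*"
    proof induction
      case (step y z)
      then have yz: "(y, z) \<in> F" "z \<in> N" "y \<in> D" by auto
      then have "(z, y) \<in> F" using symF by (auto dest: symD)
      then have "z \<in> D" using yz by (auto simp: D_def intro: converse_rtrancl_into_rtrancl)
      then show ?case
        using step.IH yz by (auto simp: F_def intro: rtrancl_into_rtrancl)
    qed (use \<open>x \<in> D\<close> in simp)
    then show "(x, y) \<in> (E \<inter> D \<times> D)\<^sup>*" by simp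
  qed
  moreover have "D \<noteq> {}" using adj \<open>B \<in> P\<close> by blast
  moreover have disj: "D \<inter> X = {}" if "X \<in> P" for X
    using PW[OF that] by (auto simp: D_def)
  moreover have "\<exists>x\<in>X. \<exists>d\<in>D. (x, d) \<in> E" "\<exists>d\<in>D. \<exists>x\<in>X. (d, x) \<in> E" if "X \<in> P" for X
    using adj[OF that] by blast+
  moreover have "X \<inter> D = {}" if "X \<in> P" for X
    using disj[OF that] by blast
  ultimately have "clique_model E (insert D P)"
    using assms(2) by (simp add: clique_model_def)
  moreover have "D \<notin> P" using disj \<open>D \<noteq> {}\<close> by blast
  moreover have "D \<subseteq> W" using NW by (auto simp: D_def)
  ultimately show thesis using that by blast
qed

section \<open>Induction on the number of colours\<close>

text \<open>The relation \<open>E\<close> stays fixed while \<open>W\<close> shrinks. Neighbours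
  outside \<open>W\<close> do not disturb the counts, since the colour classes lie inside
  \<open>W\<close>.\<close>

lemma odd_selector_of_no_clique_model:
  assumes "finite W" "sym E" "irrefl E"
    and "\<nexists>P. clique_model E P \<and> card P = Suc k + 2 \<and> \<Union>P \<subseteq> W"
  shows "\<exists>S \<phi>. S \<subseteq> W \<and> (\<forall>x\<in>S. \<forall>y\<in>S. (x, y) \<notin> E) \<and> \<phi> \<in> S \<rightarrow> {1..Suc k} \<and>
    (\<forall>x\<in>W. \<exists>i\<in>{1..Suc k}. odd (card (insert x (E `` {x}) \<inter> {y \<in> S. \<phi> y = i})))"
  using assms(1,4)
proof (induction k arbitrary: W)
  case 0
  have "Suc 0 + 2 = (3::nat)" by simp
  \<comment> \<open>Forbidding \<open>Some False\<close> everywhere says that a vertex outside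
    \<open>S\<close> has an odd number of neighbours in \<open>S\<close>.\<close>
  with 0 obtain S where "avoiding_set E W (\<lambda>_. Some False) S"
    using exists_avoiding_set_forest[OF 0(1) assms(2,3)] by metis
  then have S: "S \<subseteq> W" "\<forall>x\<in>S. \<forall>y\<in>S. (x, y) \<notin> E"
    and dom: "\<forall>x\<in>W. domination_state E S x \<noteq> Some False"
    by (simp_all add: avoiding_set_def)
  have "odd (card (insert x (E `` {x}) \<inter> S))" if "x \<in> W" for x
  proof (cases "x \<in> S")
    case True
    then have "insert x (E `` {x}) \<inter> S = {x}" using S(2) by auto
    then show ?thesis by simp
  next
    case False
    then have "insert x (E `` {x}) \<inter> S = E `` {x} \<inter> S" by auto
    then show ?thesis using dom that False by (auto simp: domination_state_def)
  qed
  then show ?case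
    using S by (intro exI[of _ S] exI[of _ "\<lambda>_. 1"]) auto
next
  case (Suc k)
  define F where "F = E \<inter> W \<times> W"
  have F: "F \<subseteq> W \<times> W" "sym F" using assms(2) by (auto simp: F_def sym_def)
  obtain S where S: "S \<subseteq> W" "linked_packing F S"
    and cover: "W \<subseteq> closed_nbhd_within F S \<union> F `` closed_nbhd_within F S"
    using exists_covering_linked_packing[OF Suc.prems(1) F] .
  define N where "N = closed_nbhd_within F S"
  let ?W = "W - N"
  have "\<nexists>P. clique_model E P \<and> card P = Suc k + 2 \<and> \<Union>P \<subseteq> ?W"
  proof
    assume "\<exists>P. clique_model E P \<and> card P = Suc k + 2 \<and> \<Union>P \<subseteq> ?W"
    then obtain P where P: "clique_model E P" "card P = Suc k + 2" "\<Union>P \<subseteq> ?W" by blast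
    then have "P \<noteq> {}" "finite P" by (auto intro: card_ge_0_finite)
    obtain D where D: "clique_model E (insert D P)" "D \<notin> P" "D \<subseteq> W"
      using clique_model_extend[OF assms(2) P(1) \<open>P \<noteq> {}\<close>, of W S] P(3) S cover
      unfolding N_def F_def by blast
    moreover have "card (insert D P) = Suc (Suc k) + 2"
      using P(2) D(2) \<open>finite P\<close> by simp
    moreover have "\<Union>(insert D P) \<subseteq> W" using P(3) D(3) by auto
    ultimately show False using Suc.prems(2) by blast
  qed
  then obtain T \<psi> where T: "T \<subseteq> ?W" "\<forall>x\<in>T. \<forall>y\<in>T. (x, y) \<notin> E" "\<psi> \<in> T \<rightarrow> {1..Suc k}"
    and odd_T: "\<And>x. x \<in> ?W \<Longrightarrow>
      \<exists>i\<in>{1..Suc k}. odd (card (insert x (E `` {x}) \<inter> {y \<in> T. \<psi> y = i}))"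
    using Suc.IH[of ?W] Suc.prems(1) by auto
  define \<phi> where "\<phi> = (\<lambda>x. if x \<in> S then Suc (Suc k) else \<psi> x)"
  have SN: "S \<subseteq> N" by (auto simp: N_def closed_nbhd_within_def)
  have unique: "s = t" if "s \<in> S" "t \<in> S" "x \<in> closed_nbhd_within F {s}" "x \<in> closed_nbhd_within F {t}"
    for s t x
    using S(2) that unfolding linked_packing_def by blast
  have "(x, y) \<notin> E" if "x \<in> S" "y \<in> S" for x y
  proof
    assume "(x, y) \<in> E"
    then have "(x, y) \<in> F" using that S(1) by (auto simp: F_def)
    then have "x = y" using unique[OF that, of y] by (simp add: closed_nbhd_within_def)
    with \<open>(x, y) \<in> E\<close> assms(3) show False by (simp add: irrefl_def)
  qed
  moreover have "(x, y) \<notin> E" "(y, x) \<notin> E" if "x \<in> S" "y \<in> T" for x y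
  proof -
    \<comment> \<open>A neighbour of \<open>S\<close> inside \<open>W\<close> belongs to
      \<open>N\<close>, which \<open>T\<close> avoids.\<close>
    show "(x, y) \<notin> E"
      using that S(1) T(1) by (auto simp: N_def F_def closed_nbhd_within_def)
    then show "(y, x) \<notin> E" using assms(2) by (auto dest: symD)
  qed
  ultimately have indep: "\<forall>x\<in>S \<union> T. \<forall>y\<in>S \<union> T. (x, y) \<notin> E"
    using T(2) by blast
  \<comment> \<open>The colours used on \<open>T\<close> stop at \<open>Suc k\<close>, so the new
    colour occurs on \<open>S\<close> alone and the old colour classes are unchanged.\<close>
  have col_S: "{y \<in> S \<union> T. \<phi> y = Suc (Suc k)} = S"
    using T(3) by (force simp: \<phi>_def)
  have col_T: "{y \<in> S \<union> T. \<phi> y = i} = {y \<in> T. \<psi> y = i}" if "i \<in> {1..Suc k}" for i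
    using that T(1) SN by (auto simp: \<phi>_def)
  have "\<exists>i\<in>{1..Suc (Suc k)}. odd (card (insert x (E `` {x}) \<inter> {y \<in> S \<union> T. \<phi> y = i}))"
    if "x \<in> W" for x
  proof (cases "x \<in> N")
    case True
    then obtain s where s: "s \<in> S" "x \<in> closed_nbhd_within F {s}"
      by (auto simp: N_def closed_nbhd_within_def)
    have "insert x (E `` {x}) \<inter> S = {s}"
    proof
      show "{s} \<subseteq> insert x (E `` {x}) \<inter> S"
        using s assms(2) by (auto simp: closed_nbhd_within_def F_def dest: symD)
      show "insert x (E `` {x}) \<inter> S \<subseteq> {s}"
      proof
        fix t assume t: "t \<in> insert x (E `` {x}) \<inter> S"
        then have "x \<in> closed_nbhd_within F {t}"
          using that S(1) assms(2) by (auto simp: closed_nbhd_within_def F_def dest: symD)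
        then show "t \<in> {s}" using unique s t by blast
      qed
    qed
    then show ?thesis using col_S by (intro bexI[of _ "Suc (Suc k)"]) simp_all
  next
    case False
    then obtain i where "i \<in> {1..Suc k}" "odd (card (insert x (E `` {x}) \<inter> {y \<in> T. \<psi> y = i}))"
      using odd_T[of x] \<open>x \<in> W\<close> by blast
    then show ?thesis using col_T[of i] by (intro bexI[of _ i]) auto
  qed
  moreover have "\<phi> \<in> S \<union> T \<rightarrow> {1..Suc (Suc k)}"
    using T(3) by (auto simp: \<phi>_def Pi_iff le_SucI)
  ultimately show ?case
    using indep S(1) T(1) by (intro exI[of _ "S \<union> T"] exI[of _ \<phi>]) blast
qed

theorem lemma2p8:
  fixes G :: "'a pair_pre_digraph" and k :: nat
  assumes "k \<ge> 1"
    and "pair_graph G"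
    and "\<not> has_complete_minor G (k + 2)"
  shows "\<exists>S \<phi>. selector Lambda_odd k G S \<phi>"
proof -
  \<comment> \<open>With \<open>k = Suc m\<close> the induction starts at \<open>m = 0\<close>, the
    case of an excluded triangle minor.\<close>
  obtain m where k: "k = Suc m" using assms(1) by (cases k) auto
  have "finite (pverts G)" "sym (parcs G)" "irrefl (parcs G)"
    using assms(2) by (simp_all add: pair_graph_iff)
  moreover have "\<nexists>P. clique_model (parcs G) P \<and> card P = Suc m + 2 \<and> \<Union>P \<subseteq> pverts G"
    using clique_model_has_complete_minor[OF assms(2)] assms(3) k by metis
  ultimately obtain S \<phi> where "S \<subseteq> pverts G" "\<forall>x\<in>S. \<forall>y\<in>S. (x, y) \<notin> parcs G"
    "\<phi> \<in> S \<rightarrow> {1..k}"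
    "\<forall>x\<in>pverts G. \<exists>i\<in>{1..k}.
      odd (card (insert x (parcs G `` {x}) \<inter> {y \<in> S. \<phi> y = i}))"
    using odd_selector_of_no_clique_model[of "pverts G" "parcs G" m] unfolding k by blast
  then have "selector Lambda_odd k G S \<phi>"
    by (simp add: selector_def independent_set_def closed_nbhd_def Lambda_odd_def Image_singleton)
  then show ?thesis by blast
qed

end
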